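(* For every fixed integer $a\geq 2$, the limit \[ \lim_{q\rightarrow\infty}\frac{\chi_{sc2}(K_{a,q})-2q}{\sqrt{q}} \] exists.
   Context: $K_{a,q}$ is the complete bipartite graph with parts $A$, $|A|=a$, and $Q$, $|Q|=q$. For a graph $G=(V,E)$ and $f:V\to\mathbb{N}$, an $f$-assignment is an assignment of color lists $L(v)$ with $|L(v)|=f(v)$; $G$ is $f$-choosable if for every $f$-assignment $L$ there is a proper coloring $c$ with $c(v)\in L(v)$ for all $v$. A function $f$ on $V(K_{a,q})$ is of type II if $f(v)=2$ for all $v\in Q$. $\chi_{sc2}(K_{a,q})$ is the minimum of $\sum_{v\in A\cup Q}f(v)$ over all type II functions $f$ such that $K_{a,q}$ is $f$-choosable. *)

theory Defs
  imports "HOL-Analysis.Analysis"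
begin

text \<open>A graph is given by its vertex set \<open>V\<close> and its set \<open>E\<close> of edges, the edges being
  two-element subsets of \<open>V\<close>. Colors are natural numbers; since only finite graphs and finite
  lists occur, any infinite stock of colors gives the same notions.\<close>

text \<open>The finiteness condition matters: \<^term>\<open>card\<close> of an infinite set is \<open>0\<close>.\<close>

definition list_assignment :: "'v set \<Rightarrow> ('v \<Rightarrow> nat) \<Rightarrow> ('v \<Rightarrow> nat set) \<Rightarrow> bool" where
  "list_assignment V f L \<longleftrightarrow> (\<forall>v\<in>V. finite (L v) \<and> card (L v) = f v)"

definition proper_coloring :: "'v set set \<Rightarrow> ('v \<Rightarrow> nat) \<Rightarrow> bool" where
  "proper_coloring E c \<longleftrightarrow> (\<forall>u v. {u, v} \<in> E \<longrightarrow> c u \<noteq> c v)"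

definition choosable :: "'v set \<Rightarrow> 'v set set \<Rightarrow> ('v \<Rightarrow> nat) \<Rightarrow> bool" where
  "choosable V E f \<longleftrightarrow>
     (\<forall>L. list_assignment V f L \<longrightarrow> (\<exists>c. proper_coloring E c \<and> (\<forall>v\<in>V. c v \<in> L v)))"

definition K_A :: "nat \<Rightarrow> (nat + nat) set" where
  "K_A a = Inl ` {..<a}"

definition K_Q :: "nat \<Rightarrow> (nat + nat) set" where
  "K_Q q = Inr ` {..<q}"

definition K_verts :: "nat \<Rightarrow> nat \<Rightarrow> (nat + nat) set" where
  "K_verts a q = K_A a \<union> K_Q q"

definition K_edges :: "nat \<Rightarrow> nat \<Rightarrow> (nat + nat) set set" where
  "K_edges a q = {{u, v} | u v. u \<in> K_A a \<and> v \<in> K_Q q}"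

definition type_II :: "nat \<Rightarrow> (nat + nat \<Rightarrow> nat) \<Rightarrow> bool" where
  "type_II q f \<longleftrightarrow> (\<forall>v\<in>K_Q q. f v = 2)"

definition chi_sc2 :: "nat \<Rightarrow> nat \<Rightarrow> nat" where
  "chi_sc2 a q = (LEAST s. \<exists>f. type_II q f \<and> choosable (K_verts a q) (K_edges a q) f \<and>
                                s = (\<Sum>v\<in>K_verts a q. f v))"

text \<open>The set minimized over in \<^const>\<open>chi_sc2\<close> is never empty, so the minimum is attained.\<close>

lemma ex_type_II_choosable:
  "\<exists>f. type_II q f \<and> choosable (K_verts a q) (K_edges a q) f"
proof (intro exI conjI)
  let ?f = "case_sum (\<lambda>_. 2 * q + 1) (\<lambda>_. 2) :: nat + nat \<Rightarrow> nat"
  show "type_II q ?f" by (auto simp: type_II_def K_Q_def)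
  show "choosable (K_verts a q) (K_edges a q) ?f"
    unfolding choosable_def
  proof (intro allI impI)
    fix L assume L: "list_assignment (K_verts a q) ?f L"
    define U where "U = (\<Union>j<q. L (Inr j))"
    have LA: "finite (L (Inl i)) \<and> card (L (Inl i)) = 2 * q + 1" if "i < a" for i
      using L that by (force simp: list_assignment_def K_verts_def K_A_def)
    have LQ: "finite (L (Inr j)) \<and> card (L (Inr j)) = 2" if "j < q" for j
      using L that by (force simp: list_assignment_def K_verts_def K_Q_def)
    have "card U \<le> (\<Sum>j<q. card (L (Inr j)))"
      unfolding U_def by (rule card_UN_le) simp
    also have "\<dots> = 2 * q" using LQ by simp
    finally have cU: "card U \<le> 2 * q" .
    have fU: "finite U" using LQ by (auto simp: U_def)
    have "\<exists>x. x \<in> L (Inl i) - U" if "i < a" for i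
    proof (rule ccontr)
      assume "\<nexists>x. x \<in> L (Inl i) - U"
      then have "card (L (Inl i)) \<le> card U" by (intro card_mono fU) auto
      with LA[OF that] cU show False by simp
    qed
    then obtain g where g: "\<And>i. i < a \<Longrightarrow> g i \<in> L (Inl i) - U" by metis
    have "\<exists>x. x \<in> L (Inr j)" if "j < q" for j
      using LQ[OF that] by (metis card.empty ex_in_conv zero_neq_numeral)
    then obtain h where h: "\<And>j. j < q \<Longrightarrow> h j \<in> L (Inr j)" by metis
    have ne: "g i \<noteq> h j" if "i < a" "j < q" for i j
      using g[OF that(1)] h[OF that(2)] that(2) by (auto simp: U_def)
    show "\<exists>c. proper_coloring (K_edges a q) c \<and> (\<forall>v\<in>K_verts a q. c v \<in> L v)"
    proof (intro exI conjI)
      show "proper_coloring (K_edges a q) (case_sum g h)"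
        using ne by (fastforce simp: proper_coloring_def K_edges_def K_A_def K_Q_def doubleton_eq_iff)
      show "\<forall>v\<in>K_verts a q. case_sum g h v \<in> L v"
        using g h by (auto simp: K_verts_def K_A_def K_Q_def)
    qed
  qed
qed

end

theory Submission
  imports Defs
begin

text \<open>Let \<open>S q = chi_sc2 a q - 2 q\<close> be the total list size on \<open>A\<close> in an optimal type II function.
  Replacing every color by \<open>k\<close> copies turns an uncolorable assignment with \<open>q\<close> pairs on \<open>Q\<close> into
  one with \<open>k\<^sup>2 q\<close> pairs whose lists on \<open>A\<close> are \<open>k\<close> times as long. After rounding list sizes up to
  multiples of \<open>k\<close> this gives \<open>k (S q - a) \<le> S (k\<^sup>2 q)\<close>. As \<open>S\<close> is monotone, a Fekete-type argument
  shows that \<open>S q / sqrt q\<close> tends to the supremum of \<open>(S q - a) / sqrt q\<close>, which is finite because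
  a random choice of colors on \<open>A\<close> shows that lists of size slightly more than \<open>a sqrt q\<close>
  suffice.\<close>

section \<open>A Fekete-type lemma\<close>

text \<open>The limit is the supremum \<open>l\<close> of \<open>h\<close>. Terms exceed
  \<open>l\<close> by at most \<open>a / sqrt q\<close>. Conversely, fix \<open>q\<close> with
  \<open>h q\<close> near \<open>l\<close> and compare a large \<open>q'\<close> with a square
  multiple of \<open>q\<close> just below it; the loss is of order
  \<open>1 / sqrt q'\<close>.\<close>

lemma convergent_div_sqrt_of_square_superadditive:
  fixes S :: "nat \<Rightarrow> real" and a B :: real
  assumes mono: "\<And>q q'. q \<le> q' \<Longrightarrow> S q \<le> S q'"
    and super: "\<And>k q. k > 0 \<Longrightarrow> real k * (S q - a) \<le> S (k\<^sup>2 * q)"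
    and bound: "\<And>q. q > 0 \<Longrightarrow> S q \<le> B * sqrt (real q)"
    and "a \<ge> 0" "\<And>q. S q \<ge> 0"
  shows "convergent (\<lambda>q. S q / sqrt (real q))"
proof -
  define h where "h q = (S q - a) / sqrt (real q)" for q
  define l where "l = (SUP q\<in>{0<..}. h q)"
  have "h q \<le> B" if "q > 0" for q
    using bound[OF that] \<open>a \<ge> 0\<close> that by (simp add: h_def divide_le_eq)
  then have bdd: "bdd_above (h ` {0<..})"
    by (auto intro!: bdd_aboveI)
  have inv0: "(\<lambda>q. C / sqrt (real q)) \<longlonglongrightarrow> 0" for C :: real
    by (intro tendsto_divide_0[OF tendsto_const] filterlim_at_top_imp_at_infinity
        filterlim_compose[OF sqrt_at_top] filterlim_real_sequentially)
  have upper: "S q / sqrt (real q) \<le> l + a / sqrt (real q)" if "q > 0" for q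
  proof -
    have "h q \<le> l" unfolding l_def by (rule cSUP_upper[OF _ bdd]) (use that in auto)
    then show ?thesis by (simp add: h_def diff_divide_distrib)
  qed
  have lower: "h q - \<bar>S q - a\<bar> / sqrt (real q') \<le> S q' / sqrt (real q')"
    if "0 < q" "0 < q'" for q q'
  proof -
    \<comment> \<open>\<open>x\<close> is the exact scaling factor with \<open>x^2 * q = q'\<close>,
      and \<open>k\<close> is its integer part.\<close>
    define x where "x = sqrt (real q') / sqrt (real q)"
    define k where "k = nat \<lfloor>x\<rfloor>"
    have "x \<ge> 0" by (simp add: x_def)
    then have k: "real k \<le> x" "x - 1 \<le> real k" unfolding k_def by linarith+
    have "(real k)\<^sup>2 * real q \<le> x\<^sup>2 * real q"
      using k(1) by (intro mult_right_mono power_mono) auto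
    also have "\<dots> = real q'" using that by (simp add: x_def power_divide)
    finally have "k\<^sup>2 * q \<le> q'" by (simp flip: of_nat_power of_nat_mult)
    \<comment> \<open>Rounding \<open>x\<close> down to \<open>k\<close> changes the product by at
      most one multiple of \<open>S q - a\<close>; the absolute value covers a negative
      difference.\<close>
    have "x * (S q - a) - \<bar>S q - a\<bar> \<le> real k * (S q - a)"
    proof (cases "S q - a \<ge> 0")
      case True
      then show ?thesis using mult_right_mono[OF k(2) True] by (simp add: algebra_simps)
    next
      case False
      then have "x * (S q - a) \<le> real k * (S q - a)" by (intro mult_right_mono_neg k) simp
      then show ?thesis using False by linarith
    qed
    also have "\<dots> \<le> S q'"
    \<comment> \<open>\<open>k = 0\<close> happens exactly when \<open>q' < q\<close>;
      superadditivity says nothing there, but nonnegativity of \<open>S\<close> suffices.\<close>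
    proof (cases "k = 0")
      case True
      then show ?thesis using assms(5) by simp
    next
      case False
      then show ?thesis using super[of k q] mono[OF \<open>k\<^sup>2 * q \<le> q'\<close>] by simp
    qed
    finally have "(x * (S q - a) - \<bar>S q - a\<bar>) / sqrt (real q') \<le> S q' / sqrt (real q')"
      by (rule divide_right_mono) simp
    then show ?thesis using that by (simp add: x_def h_def diff_divide_distrib)
  qed
  have "(\<lambda>q. S q / sqrt (real q)) \<longlonglongrightarrow> l"
  proof (rule order_tendstoI)
    fix b assume "b < l"
    then obtain q where q: "q > 0" "b < h q"
      using less_cSUP_iff[OF _ bdd] by (auto simp: l_def)
    have "(\<lambda>q'. h q - \<bar>S q - a\<bar> / sqrt (real q')) \<longlonglongrightarrow> h q - 0"
      by (intro tendsto_intros inv0)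
    then have "\<forall>\<^sub>F q' in sequentially. b < h q - \<bar>S q - a\<bar> / sqrt (real q')"
      by (rule order_tendstoD(1)) (use q(2) in simp)
    then show "\<forall>\<^sub>F q' in sequentially. b < S q' / sqrt (real q')"
      using eventually_gt_at_top[of 0]
    proof eventually_elim
      case (elim q')
      then show ?case using lower[OF q(1), of q'] by linarith
    qed
  next
    fix b assume "l < b"
    have "(\<lambda>q. l + a / sqrt (real q)) \<longlonglongrightarrow> l + 0"
      by (intro tendsto_intros inv0)
    then have "\<forall>\<^sub>F q in sequentially. l + a / sqrt (real q) < b"
      by (rule order_tendstoD(2)) (use \<open>l < b\<close> in simp)
    then show "\<forall>\<^sub>F q in sequentially. S q / sqrt (real q) < b"
      using eventually_gt_at_top[of 0]
    proof eventually_elim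
      case (elim q)
      then show ?case using upper[of q] by linarith
    qed
  qed
  then show ?thesis by (rule convergentI)
qed

section \<open>Choosing colors on \<open>A\<close> only\<close>

text \<open>A coloring of \<open>A\<close> extends to the \<open>j\<close>-th vertex of \<open>Q\<close> unless it uses both colors
  of the list \<open>D j\<close>.\<close>

definition pair_choosable :: "nat \<Rightarrow> nat \<Rightarrow> (nat \<Rightarrow> nat) \<Rightarrow> bool" where
  "pair_choosable a q g \<longleftrightarrow>
     (\<forall>(L :: nat \<Rightarrow> nat set) (D :: nat \<Rightarrow> nat set).
       (\<forall>i<a. finite (L i) \<and> card (L i) = g i) \<longrightarrow> (\<forall>j<q. card (D j) = 2) \<longrightarrow>
       (\<exists>c. (\<forall>i<a. c i \<in> L i) \<and> (\<forall>j<q. \<not> D j \<subseteq> c ` {..<a})))"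

lemma pair_choosableE:
  fixes L D :: "nat \<Rightarrow> nat set"
  assumes "pair_choosable a q g"
    and "\<And>i. i < a \<Longrightarrow> finite (L i)" "\<And>i. i < a \<Longrightarrow> card (L i) = g i"
    and "\<And>j. j < q \<Longrightarrow> card (D j) = 2"
  obtains c where "\<And>i. i < a \<Longrightarrow> c i \<in> L i" "\<And>j. j < q \<Longrightarrow> \<not> D j \<subseteq> c ` {..<a}"
  using assms(1)[unfolded pair_choosable_def, rule_format, of L D] assms(2-4) that by blast

lemma choosable_iff_pair_choosable:
  assumes "type_II q f"
  shows "choosable (K_verts a q) (K_edges a q) f \<longleftrightarrow> pair_choosable a q (\<lambda>i. f (Inl i))"
proof
  assume ch: "choosable (K_verts a q) (K_edges a q) f"
  show "pair_choosable a q (\<lambda>i. f (Inl i))"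
    unfolding pair_choosable_def
  proof (intro allI impI)
    fix L D :: "nat \<Rightarrow> nat set"
    assume L: "\<forall>i<a. finite (L i) \<and> card (L i) = f (Inl i)" and D: "\<forall>j<q. card (D j) = 2"
    have "list_assignment (K_verts a q) f (case_sum L D)"
      using L D assms
      by (auto simp: list_assignment_def K_verts_def K_A_def K_Q_def type_II_def
          intro: card_ge_0_finite)
    then obtain c where c: "proper_coloring (K_edges a q) c"
      "\<forall>v\<in>K_verts a q. c v \<in> case_sum L D v"
      using ch unfolding choosable_def by blast
    have ne: "c (Inl i) \<noteq> c (Inr j)" if "i < a" "j < q" for i j
    proof -
      have "{Inl i, Inr j} \<in> K_edges a q"
        using that unfolding K_edges_def K_A_def K_Q_def by blast
      then show ?thesis using c(1) by (simp add: proper_coloring_def)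
    qed
    have "c (Inl i) \<in> L i" if "i < a" for i
      using c(2) that by (force simp: K_verts_def K_A_def)
    moreover have "\<not> D j \<subseteq> (\<lambda>i. c (Inl i)) ` {..<a}" if "j < q" for j
    proof -
      have "c (Inr j) \<in> D j" using c(2) that by (force simp: K_verts_def K_Q_def)
      then show ?thesis using ne[OF _ that] by force
    qed
    ultimately show "\<exists>c. (\<forall>i<a. c i \<in> L i) \<and> (\<forall>j<q. \<not> D j \<subseteq> c ` {..<a})"
      by (intro exI[of _ "\<lambda>i. c (Inl i)"]) blast
  qed
next
  assume pc: "pair_choosable a q (\<lambda>i. f (Inl i))"
  show "choosable (K_verts a q) (K_edges a q) f"
    unfolding choosable_def
  proof (intro allI impI)
    fix L assume L: "list_assignment (K_verts a q) f L"
    have LA: "finite (L (Inl i))" "card (L (Inl i)) = f (Inl i)" if "i < a" for i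
      using L that by (auto simp: list_assignment_def K_verts_def K_A_def)
    have LQ: "card (L (Inr j)) = 2" if "j < q" for j
      using L that assms by (force simp: list_assignment_def K_verts_def K_Q_def type_II_def)
    obtain g where g: "\<And>i. i < a \<Longrightarrow> g i \<in> L (Inl i)"
        "\<And>j. j < q \<Longrightarrow> \<not> L (Inr j) \<subseteq> g ` {..<a}"
      using pair_choosableE[OF pc, of "\<lambda>i. L (Inl i)" "\<lambda>j. L (Inr j)"] LA LQ by blast
    \<comment> \<open>Vertices of \<open>Q\<close> are pairwise non-adjacent, so each can pick a
      color avoiding those on \<open>A\<close> independently of the others.\<close>
    have "\<exists>x. x \<in> L (Inr j) - g ` {..<a}" if "j < q" for j
      using g(2)[OF that] by blast
    then obtain h where h: "\<And>j. j < q \<Longrightarrow> h j \<in> L (Inr j) - g ` {..<a}"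
      by metis
    have ne: "g i \<noteq> h j" if "i < a" "j < q" for i j
      using h[OF that(2)] that(1) by force
    show "\<exists>c. proper_coloring (K_edges a q) c \<and> (\<forall>v\<in>K_verts a q. c v \<in> L v)"
    proof (intro exI conjI)
      show "proper_coloring (K_edges a q) (case_sum g h)"
        using ne by (fastforce simp: proper_coloring_def K_edges_def K_A_def K_Q_def doubleton_eq_iff)
      show "\<forall>v\<in>K_verts a q. case_sum g h v \<in> L v"
        using g h by (auto simp: K_verts_def K_A_def K_Q_def)
    qed
  qed
qed

lemma sum_type_II:
  assumes "type_II q f"
  shows "(\<Sum>v\<in>K_verts a q. f v) = (\<Sum>i<a. f (Inl i)) + 2 * q"
proof -
  have "(\<Sum>v\<in>K_verts a q. f v) = (\<Sum>v\<in>K_A a. f v) + (\<Sum>v\<in>K_Q q. f v)"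
    unfolding K_verts_def by (intro sum.union_disjoint) (auto simp: K_A_def K_Q_def)
  also have "(\<Sum>v\<in>K_Q q. f v) = 2 * q"
    using assms by (simp add: type_II_def K_Q_def sum.reindex)
  finally show ?thesis by (simp add: K_A_def sum.reindex)
qed

text \<open>Together with \<open>chi_sc2_attained\<close> this turns the minimization into one over
  list sizes on \<open>A\<close> alone, since \<open>Q\<close> always contributes
  \<open>2 * q\<close>.\<close>

lemma chi_sc2_le:
  assumes "pair_choosable a q g"
  shows "chi_sc2 a q \<le> sum g {..<a} + 2 * q"
proof -
  let ?f = "case_sum g (\<lambda>_. 2)"
  have II: "type_II q ?f" by (auto simp: type_II_def K_Q_def)
  then have "choosable (K_verts a q) (K_edges a q) ?f"
    using assms by (simp add: choosable_iff_pair_choosable)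
  with II show ?thesis
    unfolding chi_sc2_def by (intro Least_le exI[of _ ?f]) (simp add: sum_type_II)
qed

lemma chi_sc2_attained:
  obtains g where "pair_choosable a q g" "chi_sc2 a q = sum g {..<a} + 2 * q"
proof -
  have "\<exists>f. type_II q f \<and> choosable (K_verts a q) (K_edges a q) f \<and>
      chi_sc2 a q = (\<Sum>v\<in>K_verts a q. f v)"
    unfolding chi_sc2_def by (rule LeastI_ex) (use ex_type_II_choosable in blast)
  then obtain f where "type_II q f" "choosable (K_verts a q) (K_edges a q) f"
    "chi_sc2 a q = (\<Sum>v\<in>K_verts a q. f v)" by blast
  then show ?thesis
    using that by (simp add: choosable_iff_pair_choosable sum_type_II)
qed

section \<open>Monotonicity, blow-up and the random bound\<close>

lemma pair_choosable_mono:
  assumes "pair_choosable a q g" "\<And>i. i < a \<Longrightarrow> g i \<le> g' i"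
  shows "pair_choosable a q g'"
  unfolding pair_choosable_def
proof (intro allI impI)
  fix L D :: "nat \<Rightarrow> nat set"
  assume L: "\<forall>i<a. finite (L i) \<and> card (L i) = g' i" and D: "\<forall>j<q. card (D j) = 2"
  have "\<exists>M. M \<subseteq> L i \<and> card M = g i \<and> finite M" if "i < a" for i
    using obtain_subset_with_card_n[of "g i" "L i"] L assms(2)[OF that] that by metis
  then obtain M where M: "\<And>i. i < a \<Longrightarrow> M i \<subseteq> L i \<and> card (M i) = g i \<and> finite (M i)"
    by metis
  obtain c where "\<And>i. i < a \<Longrightarrow> c i \<in> M i" "\<And>j. j < q \<Longrightarrow> \<not> D j \<subseteq> c ` {..<a}"
    using pair_choosableE[OF assms(1), of M D] M D by blast
  with M show "\<exists>c. (\<forall>i<a. c i \<in> L i) \<and> (\<forall>j<q. \<not> D j \<subseteq> c ` {..<a})"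
    by blast
qed

lemma pair_choosable_antimono:
  assumes "pair_choosable a q' g" "q \<le> q'"
  shows "pair_choosable a q g"
  unfolding pair_choosable_def
proof (intro allI impI)
  fix L D :: "nat \<Rightarrow> nat set"
  assume L: "\<forall>i<a. finite (L i) \<and> card (L i) = g i" and D: "\<forall>j<q. card (D j) = 2"
  \<comment> \<open>The missing pairs are filled with an arbitrary two-element set; extra
    constraints only make the coloring harder to find.\<close>
  let ?D = "\<lambda>j. if j < q then D j else {0, 1}"
  have "card (?D j) = 2" for j using D by simp
  then obtain c where c: "\<And>i. i < a \<Longrightarrow> c i \<in> L i" "\<And>j. j < q' \<Longrightarrow> \<not> ?D j \<subseteq> c ` {..<a}"
    using pair_choosableE[OF assms(1), of L ?D] L by blast
  have "\<not> D j \<subseteq> c ` {..<a}" if "j < q" for j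
    using c(2)[of j] that assms(2) by simp
  with c(1) show "\<exists>c. (\<forall>i<a. c i \<in> L i) \<and> (\<forall>j<q. \<not> D j \<subseteq> c ` {..<a})"
    by blast
qed

text \<open>The copies of a color \<open>x\<close> are \<open>k * x, \<dots>, k * x + k - 1\<close>, and the \<open>k\<^sup>2\<close> copies of the
  \<open>j\<close>-th pair have the indices \<open>(j * k + r) * k + s\<close> for \<open>r, s < k\<close>.\<close>

lemma pair_choosable_blow_up:
  assumes "pair_choosable a (k\<^sup>2 * q) (\<lambda>i. k * g i)" "k > 0"
  shows "pair_choosable a q g"
  unfolding pair_choosable_def
proof (intro allI impI)
  fix L D :: "nat \<Rightarrow> nat set"
  assume L: "\<forall>i<a. finite (L i) \<and> card (L i) = g i" and D: "\<forall>j<q. card (D j) = 2"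
  from D have "\<exists>u v. D j = {u, v} \<and> u \<noteq> v" if "j < q" for j
    using that by (simp add: card_2_iff)
  then obtain u v where uv: "\<And>j. j < q \<Longrightarrow> D j = {u j, v j} \<and> u j \<noteq> v j" by metis
  define L' where "L' i = (\<lambda>(x, r). k * x + r) ` (L i \<times> {..<k})" for i
  \<comment> \<open>Writing \<open>m = (j * k + r) * k + s\<close>, the pair \<open>D' m\<close>
    joins copy \<open>r\<close> of \<open>u j\<close> to copy \<open>s\<close> of
    \<open>v j\<close>.\<close>
  define D' where "D' m = {k * u (m div k div k) + m div k mod k, k * v (m div k div k) + m mod k}"
    for m
  have div_copy: "(k * x + r) div k = x" if "r < k" for x r using that by simp
  have inj: "inj_on (\<lambda>(x, r). k * x + r) (X \<times> {..<k})" for X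
  proof (rule inj_onI, clarsimp)
    fix x r y s assume "r < k" "s < k" and eq: "k * x + r = k * y + s"
    then have "x = y" using div_copy by metis
    with eq show "x = y \<and> r = s" by simp
  qed
  have "card (D' m) = 2" if "m < k\<^sup>2 * q" for m
  proof -
    have "m div k div k < q"
      using that \<open>k > 0\<close> by (simp add: less_mult_imp_div_less power2_eq_square mult.commute flip: div_mult2_eq)
    then have "u (m div k div k) \<noteq> v (m div k div k)" using uv by blast
    then have "k * u (m div k div k) + m div k mod k \<noteq> k * v (m div k div k) + m mod k"
      using \<open>k > 0\<close> div_copy by (metis mod_less_divisor)
    then show ?thesis by (simp add: D'_def)
  qed
  moreover have "finite (L' i)" "card (L' i) = k * g i" if "i < a" for i
    using L that by (auto simp: L'_def card_image[OF inj])
  ultimately obtain c where c: "\<And>i. i < a \<Longrightarrow> c i \<in> L' i"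
      "\<And>m. m < k\<^sup>2 * q \<Longrightarrow> \<not> D' m \<subseteq> c ` {..<a}"
    using pair_choosableE[OF assms(1), of L' D'] by blast
  \<comment> \<open>Dividing by \<open>k\<close> sends a copy back to its original color, so a good
    coloring of the blow-up projects to one of the original lists.\<close>
  have "c i div k \<in> L i" if "i < a" for i
    using c(1)[OF that] by (auto simp: L'_def)
  moreover have "\<not> D j \<subseteq> (\<lambda>i. c i div k) ` {..<a}" if j: "j < q" for j
  proof
    assume "D j \<subseteq> (\<lambda>i. c i div k) ` {..<a}"
    then obtain i i' where i: "i < a" "i' < a" "u j = c i div k" "v j = c i' div k"
      using uv[OF j] by auto
    \<comment> \<open>This is the index of the pair formed by exactly the copies \<open>c i\<close>
      and \<open>c i'\<close>, so a violated pair \<open>D j\<close> lifts to a violated pair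
      \<open>D' m\<close>.\<close>
    define m where "m = (j * k + c i mod k) * k + c i' mod k"
    have m: "m div k = j * k + c i mod k" "m mod k = c i' mod k"
      using \<open>k > 0\<close> by (simp_all add: m_def)
    then have m': "m div k div k = j" "m div k mod k = c i mod k"
      using \<open>k > 0\<close> by simp_all
    have "m div (k * k) < q" using m'(1) j by (simp add: div_mult2_eq)
    then have "m < k\<^sup>2 * q" using \<open>k > 0\<close>
      by (simp add: div_less_iff_less_mult power2_eq_square mult.commute)
    moreover have "D' m = {c i, c i'}" by (simp add: D'_def m' m(2) flip: i)
        (simp add: i)
    ultimately show False using c(2)[of m] i(1,2) by simp
  qed
  ultimately show "\<exists>c. (\<forall>i<a. c i \<in> L i) \<and> (\<forall>j<q. \<not> D j \<subseteq> c ` {..<a})"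
    by (intro exI[of _ "\<lambda>i. c i div k"]) blast
qed

text \<open>Union bound over the \<open>n ^ a\<close> choices of colors: a bad choice has some
  positions \<open>i\<close>, \<open>i'\<close> carrying \<open>u j\<close> and \<open>v j\<close>.
  There are \<open>a^2 * q\<close> triples \<open>(j, i, i')\<close>, each responsible for at most
  \<open>n ^ (a - 2)\<close> bad choices.\<close>

lemma pair_choosable_const:
  assumes "a \<ge> 2" "a\<^sup>2 * q < n\<^sup>2"
  shows "pair_choosable a q (\<lambda>_. n)"
  unfolding pair_choosable_def
proof (intro allI impI, rule ccontr)
  fix L D :: "nat \<Rightarrow> nat set"
  assume L: "\<forall>i<a. finite (L i) \<and> card (L i) = n" and D: "\<forall>j<q. card (D j) = 2"
    and none: "\<not> (\<exists>c. (\<forall>i<a. c i \<in> L i) \<and> (\<forall>j<q. \<not> D j \<subseteq> c ` {..<a}))"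
  from D have "\<exists>u v. D j = {u, v} \<and> u \<noteq> v" if "j < q" for j
    using that by (simp add: card_2_iff)
  then obtain u v where uv: "\<And>j. j < q \<Longrightarrow> D j = {u j, v j} \<and> u j \<noteq> v j" by metis
  \<comment> \<open>Extensional functions are used so that the set of choices is finite and has
    exactly \<open>n ^ a\<close> elements.\<close>
  define P where "P = PiE {..<a} L"
  define X where "X = (\<lambda>(j, i, i'). {c \<in> P. c i = u j \<and> c i' = v j})"
  define T where "T = {..<q} \<times> {..<a} \<times> {..<a}"
  have finP: "finite P" using L by (auto simp: P_def intro!: finite_PiE)
  have cardX: "card (X t) \<le> n ^ (a - 2)" if t_in: "t \<in> T" for t
  proof -
    obtain j i i' where t: "t = (j, i, i')" "j < q" "i < a" "i' < a"
      using t_in by (auto simp: T_def)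
    show ?thesis
    proof (cases "i = i'")
      case True
      then have "X t = {}" using uv[OF t(2)] by (auto simp: X_def t)
      then show ?thesis by simp
    next
      case False
      \<comment> \<open>Two coordinates are pinned to singletons, leaving \<open>a - 2\<close> free
        coordinates with \<open>n\<close> options each.\<close>
      let ?M = "L(i := {u j}, i' := {v j})"
      have finM: "finite (PiE {..<a} ?M)" using L by (auto intro!: finite_PiE)
      have "X t \<subseteq> PiE {..<a} ?M"
        using t by (auto simp: X_def P_def PiE_def Pi_def)
      then have "card (X t) \<le> card (PiE {..<a} ?M)"
        by (rule card_mono[OF finM])
      also have "\<dots> = (\<Prod>m<a. card (?M m))" by (simp add: card_PiE)
      also have "\<dots> = (\<Prod>m\<in>{..<a} - {i, i'}. card (?M m))"
        by (rule prod.mono_neutral_right) auto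
      also have "\<dots> = (\<Prod>m\<in>{..<a} - {i, i'}. n)"
        using L by (intro prod.cong) auto
      also have "\<dots> = n ^ (a - 2)" using False t by (simp add: card_Diff_subset numeral_2_eq_2)
      finally show ?thesis .
    qed
  qed
  have "P \<subseteq> (\<Union>t\<in>T. X t)"
  proof
    fix c assume c: "c \<in> P"
    then obtain j where j: "j < q" "D j \<subseteq> c ` {..<a}"
      using none by (auto simp: P_def PiE_iff)
    then obtain i i' where "i < a" "i' < a" "u j = c i" "v j = c i'"
      using uv[OF j(1)] by auto
    with c j show "c \<in> (\<Union>t\<in>T. X t)"
      by (intro UN_I[of "(j, i, i')"]) (auto simp: T_def X_def)
  qed
  then have "card P \<le> card (\<Union>t\<in>T. X t)"
    using finP by (intro card_mono) (auto simp: T_def X_def)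
  also have "\<dots> \<le> (\<Sum>t\<in>T. card (X t))" by (rule card_UN_le) (simp add: T_def)
  also have "\<dots> \<le> (\<Sum>t\<in>T. n ^ (a - 2))" by (intro sum_mono cardX)
  also have "\<dots> = (a\<^sup>2 * q) * n ^ (a - 2)"
    by (simp add: T_def power2_eq_square)
  also have "\<dots> < n\<^sup>2 * n ^ (a - 2)"
    using assms(2) by (intro mult_strict_right_mono) (auto intro!: Nat.gr0I)
  also have "\<dots> = n ^ a" using assms(1) by (simp only: le_add_diff_inverse flip: power_add)
  also have "\<dots> = card P" using L by (simp add: P_def card_PiE)
  finally show False by simp
qed

section \<open>Bounds on \<open>chi_sc2 a q - 2 q\<close>\<close>

lemma chi_sc2_minus_mono:
  assumes "q \<le> q'"
  shows "real (chi_sc2 a q) - 2 * real q \<le> real (chi_sc2 a q') - 2 * real q'"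
proof -
  obtain g where "pair_choosable a q' g" and g: "chi_sc2 a q' = sum g {..<a} + 2 * q'"
    by (rule chi_sc2_attained)
  then have "chi_sc2 a q \<le> sum g {..<a} + 2 * q"
    using assms by (intro chi_sc2_le) (rule pair_choosable_antimono)
  then have "real (chi_sc2 a q) \<le> real (sum g {..<a}) + 2 * real q" by linarith
  then show ?thesis by (simp add: g)
qed

lemma chi_sc2_minus_square_superadditive:
  assumes "k > 0"
  shows "real k * (real (chi_sc2 a q) - 2 * real q - real a)
    \<le> real (chi_sc2 a (k\<^sup>2 * q)) - 2 * real (k\<^sup>2 * q)"
proof -
  obtain g where g: "pair_choosable a (k\<^sup>2 * q) g"
      "chi_sc2 a (k\<^sup>2 * q) = sum g {..<a} + 2 * (k\<^sup>2 * q)"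
    by (rule chi_sc2_attained)
  \<comment> \<open>Rounding list sizes up to multiples of \<open>k\<close> prepares for undoing the
    blow-up; the \<open>+ 1\<close> at each of the \<open>a\<close> vertices accounts for the
    subtracted \<open>real a\<close>.\<close>
  define h where "h i = g i div k + 1" for i
  have "g i \<le> k * h i" for i
    using dividend_less_times_div[OF assms, of "g i"] by (simp add: h_def)
  with g(1) have "pair_choosable a (k\<^sup>2 * q) (\<lambda>i. k * h i)"
    by (rule pair_choosable_mono)
  then have "chi_sc2 a q \<le> sum h {..<a} + 2 * q"
    using assms by (intro chi_sc2_le) (rule pair_choosable_blow_up)
  also have "sum h {..<a} = (\<Sum>i<a. g i div k) + a"
    by (simp add: h_def sum.distrib del: One_nat_def)
  finally have "real (chi_sc2 a q) - 2 * real q - real a \<le> real (\<Sum>i<a. g i div k)"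
    by linarith
  then have "real k * (real (chi_sc2 a q) - 2 * real q - real a) \<le> real k * real (\<Sum>i<a. g i div k)"
    by (rule mult_left_mono) simp
  also have "\<dots> = real (\<Sum>i<a. k * (g i div k))" by (simp add: sum_distrib_left)
  also have "\<dots> \<le> real (sum g {..<a})" by (intro of_nat_mono sum_mono) simp
  finally show ?thesis by (simp add: g(2))
qed

lemma chi_sc2_minus_le:
  assumes "a \<ge> 2" "q > 0"
  shows "real (chi_sc2 a q) - 2 * real q \<le> real (a * (a + 1)) * sqrt (real q)"
proof -
  define x where "x = real a * sqrt (real q)"
  \<comment> \<open>Floor plus one, not the ceiling, because the union bound needs
    \<open>n > x\<close> strictly even when \<open>x\<close> is an integer.\<close>
  define n where "n = nat \<lfloor>x\<rfloor> + 1"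
  have "x \<ge> 0" by (simp add: x_def)
  then have n: "x < real n" "real n \<le> x + 1" unfolding n_def by linarith+
  have "real (a\<^sup>2 * q) = x\<^sup>2" by (simp add: x_def power_mult_distrib)
  also have "\<dots> < (real n)\<^sup>2" using n(1) \<open>x \<ge> 0\<close> by (intro power_strict_mono) auto
  finally have "a\<^sup>2 * q < n\<^sup>2" by (simp only: of_nat_less_iff flip: of_nat_power)
  then have "chi_sc2 a q \<le> a * n + 2 * q"
    using chi_sc2_le[OF pair_choosable_const[OF assms(1)]] by simp
  then have "real (chi_sc2 a q) \<le> real (a * n + 2 * q)" by (rule of_nat_mono)
  \<comment> \<open>As \<open>q\<close> is positive, the rounding error 1 is at most
    \<open>sqrt q\<close>; this makes the constant \<open>a * (a + 1)\<close>.\<close>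
  moreover have "real a * real n \<le> real a * (x + sqrt (real q))"
    using n(2) assms(2) by (intro mult_left_mono order_trans[OF n(2)]) auto
  ultimately show ?thesis by (simp add: x_def algebra_simps)
qed

theorem theorem5p2:
  fixes a :: nat
  assumes "a \<ge> 2"
  shows "convergent (\<lambda>q::nat. (real (chi_sc2 a q) - 2 * real q) / sqrt (real q))"
proof (rule convergent_div_sqrt_of_square_superadditive[where a = "real a"])
  show "0 \<le> real (chi_sc2 a q) - 2 * real q" for q
    by (rule chi_sc2_attained[of a q]) (simp add: sum_nonneg)
  show "real (chi_sc2 a q) - 2 * real q \<le> real (chi_sc2 a q') - 2 * real q'" if "q \<le> q'" for q q'
    using that by (rule chi_sc2_minus_mono)
  show "real k * (real (chi_sc2 a q) - 2 * real q - real a)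
      \<le> real (chi_sc2 a (k\<^sup>2 * q)) - 2 * real (k\<^sup>2 * q)" if "k > 0" for k q
    using that by (rule chi_sc2_minus_square_superadditive)
  show "real (chi_sc2 a q) - 2 * real q \<le> real (a * (a + 1)) * sqrt (real q)" if "q > 0" for q
    using assms that by (rule chi_sc2_minus_le)
qed simp

end
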